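(* Let $b$ be a prime. Let $m,s,\alpha,d\in\mathbb{N}$ with $\alpha\ge2$, and let $\boldsymbol{\gamma}=(\gamma_u)_{u\subseteq I_s}$ be a set of non-negative weights, where $I_s=\{1,\ldots,s\}$. Let $p\in\mathbb{F}_b[x]$ with $\deg(p)=m$, $\boldsymbol{q}\in(\mathbb{F}_b[x])^{ds}$, and let $P_{b^m,ds}(\boldsymbol{q},p)=\{\boldsymbol{y}_0,\ldots,\boldsymbol{y}_{b^m-1}\}\subset[0,1)^{ds}$ be the polynomial lattice point set, $\boldsymbol{y}_n=(y_{n,1},\ldots,y_{n,ds})$, with dual net $D^{\perp}(\boldsymbol{q},p)$. Define $$B_{\alpha,d,\boldsymbol{\gamma}}(\boldsymbol{q},p)=\sum_{\emptyset\ne w\subseteq I_{ds}}\gamma_{\phi(w)}\tilde{D}_{\alpha,b,d}^{|\phi(w)|}\sum_{\substack{\boldsymbol{l}_w\in\mathbb{N}^{|w|}\\(\boldsymbol{l}_w,\boldsymbol{0})\in D^{\perp}(\boldsymbol{q},p)}}r_{\alpha,d}(\boldsymbol{l}_w).$$ For $y\in[0,1)$ define $$\chi_{\alpha,d}(y)=\frac{b-1-b^{(2\min(\alpha,d)-1)\lfloor\log_b y\rfloor}(b^{2\min(\alpha,d)}-1)}{b^{\alpha}(b^{2\min(\alpha,d)}-b)},$$ with the convention $b^{(2\min(\alpha,d)-1)\lfloor\log_b0\rfloor}=0$. 1. We have $$B_{\alpha,d,\boldsymbol{\gamma}}(\boldsymbol{q},p)=\frac{1}{b^m}\sum_{n=0}^{b^m-1}\sum_{\emptyset\ne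 u\subseteq I_s}\gamma_u\tilde{D}_{\alpha,b,d}^{|u|}\prod_{j\in u}\Big[-1+\prod_{l=1}^{d}\big(1+\chi_{\alpha,d}(y_{n,d(j-1)+l})\big)\Big].$$ 2. In the case of product weights, i.e. $\gamma_u=\prod_{j\in u}\gamma_j$ for all $u\subseteq I_s$, we have $$B_{\alpha,d,\boldsymbol{\gamma}}(\boldsymbol{q},p)=-1+\frac{1}{b^m}\sum_{n=0}^{b^m-1}\prod_{j=1}^{s}\Big[1-\gamma_j\tilde{D}_{\alpha,b,d}+\gamma_j\tilde{D}_{\alpha,b,d}\prod_{l=1}^{d}\big(1+\chi_{\alpha,d}(y_{n,d(j-1)+l})\big)\Big].$$
   Context: Notation: $\mathbb{N}=\{1,2,\ldots\}$, $\mathbb{N}_0=\mathbb{N}\cup\{0\}$, $I_n=\{1,\ldots,n\}$, $\mathbb{F}_b$ the field of $b$ elements $\{0,\ldots,b-1\}$. For $w\subseteq I_{ds}$: $\phi(w)=\{1\le j\le s: w\cap\{d(j-1)+1,\ldots,dj\}\ne\emptyset\}$; $(\boldsymbol{l}_w,\boldsymbol{0})$ is the $ds$-dimensional vector with $j$-th component $l_j$ if $j\in w$ and $0$ otherwise; $r_{\alpha,d}(\boldsymbol{l}_w)=\prod_{j\in w}r_{\alpha,d}(l_j)$ with $r_{\alpha,d}(0)=1$ and $r_{\alpha,d}(l)=b^{-2\min(\alpha,d)\mu_1(l)-\alpha}$ for $l\ge1$, where $\mu_1(l)=a$ if $b^{a-1}\le l<b^a$ (number of base-$b$ digits). Constants: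 $\tilde{D}_{\alpha,b,d}=b^{(2d-1)\alpha}D_{\alpha,b}$, $D_{\alpha,b}=\max_{1\le\nu\le\alpha}\big(C'_{\alpha,b,\nu}+\tilde{C}_{2\alpha,b}b^{-2(\alpha-\nu)}\big)$, $C'_{\alpha,b,\nu}=\sum_{\tau=\nu}^{\alpha}C_{\tau,b}^2b^{-2(\tau-\nu)}$, $C_{1,b}=(2\sin(\pi/b))^{-1}$, $C_{\tau,b}=(1+1/b+1/(b(b+1)))^{\tau-2}/(2\sin(\pi/b))^{\tau}$ for $\tau\ge2$, $\tilde{C}_{2\alpha,b}=2(1+1/b+1/(b(b+1)))^{2\alpha-2}/(2\sin(\pi/b))^{2\alpha}$. Polynomial lattice point set: identify an integer $n=\nu_0+\nu_1b+\cdots$ with the polynomial $n(x)=\nu_0+\nu_1x+\cdots\in\mathbb{F}_b[x]$; $v_m:\mathbb{F}_b((x^{-1}))\to[0,1)$, $v_m(\sum_{l=w}^{\infty}t_lx^{-l})=\sum_{l=\max(1,w)}^{m}t_lb^{-l}$. For $\deg(p)=m$ and $\boldsymbol{q}\in(\mathbb{F}_b[x])^t$, $P_{b^m,t}(\boldsymbol{q},p)$ consists of the points $\boldsymbol{y}_n=(v_m(n(x)q_1(x)/p(x)),\ldots,v_m(n(x)q_t(x)/p(x)))$, $0\le n<b^m$. Dual net: with $\mathrm{tr}_m(k)(x)=\kappa_0+\kappa_1x+\cdots+\kappa_{m-1}x^{m-1}$ for $k=\kappa_0+\kappa_1b+\cdots\in\mathbb{N}_0$, $D^{\perp}(\boldsymbol{q},p)=\{\boldsymbol{k}\in\mathbb{N}_0^t:\sum_{j=1}^{t}\mathrm{tr}_m(k_j)q_j\equiv0\pmod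 p\}$. *)

theory Defs
  imports
    "HOL-Analysis.Analysis"
    "HOL-Computational_Algebra.Formal_Laurent_Series"
    "HOL-Number_Theory.Cong"
    "Berlekamp_Zassenhaus.Finite_Field"
begin

text \<open>
  The field with a prime number \<open>b\<close> of elements is \<open>'p mod_ring\<close> with \<open>'p :: prime_card\<close> and
  \<open>b = CARD('p)\<close>; \<open>of_nat\<close> and \<open>to_int_mod_ring\<close> identify its elements with \<open>{0, ..., b - 1}\<close>.
  A \<open>t\<close>-dimensional vector is a function on \<open>nat\<close> whose components are those at \<open>1, ..., t\<close>.
\<close>

definition num_digits :: "nat \<Rightarrow> nat \<Rightarrow> nat" where
  "num_digits b l = (THE a. 1 \<le> a \<and> b ^ (a - 1) \<le> l \<and> l < b ^ a)"

definition r_weight :: "nat \<Rightarrow> nat \<Rightarrow> nat \<Rightarrow> nat \<Rightarrow> real" where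
  "r_weight b \<alpha> d l =
     (if l = 0 then 1
      else real b powi (- 2 * int (min \<alpha> d) * int (num_digits b l) - int \<alpha>))"

definition blocks :: "nat \<Rightarrow> nat \<Rightarrow> nat set \<Rightarrow> nat set" where
  "blocks d s w = {j \<in> {1..s}. w \<inter> {d * (j - 1) + 1..d * j} \<noteq> {}}"

definition zero_extend :: "nat \<Rightarrow> nat set \<Rightarrow> (nat \<Rightarrow> nat) \<Rightarrow> (nat \<Rightarrow> nat)" where
  "zero_extend t w l = (\<lambda>j\<in>{1..t}. if j \<in> w then l j else 0)"

definition C_const :: "nat \<Rightarrow> nat \<Rightarrow> real" where
  "C_const b \<tau> =
     (if \<tau> = 1 then 1 / (2 * sin (pi / real b))
      else (1 + 1 / real b + 1 / (real b * (real b + 1))) ^ (\<tau> - 2)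
             / (2 * sin (pi / real b)) ^ \<tau>)"

definition C_tilde :: "nat \<Rightarrow> nat \<Rightarrow> real" where
  "C_tilde b \<tau> =
     2 * (1 + 1 / real b + 1 / (real b * (real b + 1))) ^ (\<tau> - 2)
       / (2 * sin (pi / real b)) ^ \<tau>"

definition C_prime :: "nat \<Rightarrow> nat \<Rightarrow> nat \<Rightarrow> real" where
  "C_prime b \<alpha> \<nu> =
     (\<Sum>\<tau>=\<nu>..\<alpha>. (C_const b \<tau>)\<^sup>2 * real b powi (- 2 * (int \<tau> - int \<nu>)))"

definition D_const :: "nat \<Rightarrow> nat \<Rightarrow> real" where
  "D_const b \<alpha> =
     Max ((\<lambda>\<nu>. C_prime b \<alpha> \<nu> + C_tilde b (2 * \<alpha>) * real b powi (- 2 * (int \<alpha> - int \<nu>)))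
            ` {1..\<alpha>})"

definition D_tilde :: "nat \<Rightarrow> nat \<Rightarrow> nat \<Rightarrow> real" where
  "D_tilde b \<alpha> d = real b ^ ((2 * d - 1) * \<alpha>) * D_const b \<alpha>"

definition trunc_poly :: "nat \<Rightarrow> nat \<Rightarrow> 'p::prime_card mod_ring poly" where
  "trunc_poly m k = (\<Sum>i<m. Polynomial.monom (of_nat (k div CARD('p) ^ i mod CARD('p))) i)"

text \<open>All digits of \<open>n\<close> are at positions below \<open>n\<close>, since \<open>n < b ^ n\<close>.\<close>

definition nat_poly :: "nat \<Rightarrow> 'p::prime_card mod_ring poly" where
  "nat_poly n = trunc_poly n n"

text \<open>
  Laurent series in the inverse of \<open>x\<close>: the indeterminate \<open>fls_X\<close> stands for \<open>1 / x\<close>, so \<open>fls_nth f l\<close>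
  is the coefficient of \<open>x\<close> to the power \<open>- l\<close>, and polynomials are embedded by sending \<open>x\<close> to
  \<open>fls_X_inv\<close>.
\<close>

definition poly_to_fls :: "'a::field poly \<Rightarrow> 'a fls" where
  "poly_to_fls f = (\<Sum>i\<le>degree f. fls_const (Polynomial.coeff f i) * fls_X_inv ^ i)"

definition v_map :: "nat \<Rightarrow> 'p::prime_card mod_ring fls \<Rightarrow> real" where
  "v_map m f =
     (\<Sum>l=max 1 (fls_subdegree f)..int m.
        real_of_int (to_int_mod_ring (fls_nth f l)) * real CARD('p) powi (- l))"

definition lattice_point ::
  "nat \<Rightarrow> (nat \<Rightarrow> 'p::prime_card mod_ring poly) \<Rightarrow> 'p mod_ring poly \<Rightarrow> nat \<Rightarrow> nat \<Rightarrow> real" where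
  "lattice_point m q p n j = v_map m (poly_to_fls (nat_poly n * q j) / poly_to_fls p)"

definition dual_net ::
  "nat \<Rightarrow> nat \<Rightarrow> (nat \<Rightarrow> 'p::prime_card mod_ring poly) \<Rightarrow> 'p mod_ring poly \<Rightarrow> (nat \<Rightarrow> nat) set"
  where
  "dual_net m t q p =
     {k \<in> {1..t} \<rightarrow>\<^sub>E UNIV. [(\<Sum>j=1..t. trunc_poly m (k j) * q j) = 0] (mod p)}"

definition B_crit ::
  "nat \<Rightarrow> nat \<Rightarrow> nat \<Rightarrow> nat \<Rightarrow> (nat set \<Rightarrow> real)
     \<Rightarrow> (nat \<Rightarrow> 'p::prime_card mod_ring poly) \<Rightarrow> 'p mod_ring poly \<Rightarrow> real" where
  "B_crit m s \<alpha> d \<gamma> q p =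
     (\<Sum>w | w \<noteq> {} \<and> w \<subseteq> {1..d * s}.
        \<gamma> (blocks d s w) * D_tilde CARD('p) \<alpha> d ^ card (blocks d s w)
          * (\<Sum>\<^sub>\<infinity>l | l \<in> w \<rightarrow>\<^sub>E {1..} \<and> zero_extend (d * s) w l \<in> dual_net m (d * s) q p.
               \<Prod>j\<in>w. r_weight CARD('p) \<alpha> d (l j)))"

definition chi :: "nat \<Rightarrow> nat \<Rightarrow> nat \<Rightarrow> real \<Rightarrow> real" where
  "chi b \<alpha> d y =
     (real b - 1
       - (if y = 0 then 0 else real b powi ((2 * int (min \<alpha> d) - 1) * \<lfloor>log (real b) y\<rfloor>))
           * (real b ^ (2 * min \<alpha> d) - 1))
     / (real b ^ \<alpha> * (real b ^ (2 * min \<alpha> d) - real b))"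

lemma num_digits_eqI:
  assumes "2 \<le> b" "1 \<le> a" "b ^ (a - 1) \<le> l" "l < b ^ a"
  shows "num_digits b l = a"
  unfolding num_digits_def
proof (rule the_equality)
  fix c assume c: "1 \<le> c \<and> b ^ (c - 1) \<le> l \<and> l < b ^ c"
  have "b ^ (c - 1) < b ^ a" "b ^ (a - 1) < b ^ c" using c assms by linarith+
  hence "c - 1 < a" "a - 1 < c" using assms(1) by simp_all
  with c assms(2) show "c = a" by linarith
qed (use assms in auto)

lemma num_digits_bounds:
  assumes "2 \<le> b" "1 \<le> l"
  shows "1 \<le> num_digits b l" "b ^ (num_digits b l - 1) \<le> l" "l < b ^ num_digits b l"
proof -
  have *: "l < b ^ l" using less_exp[of l] power_mono[of 2 b l] assms(1) by linarith
  define a where "a = (LEAST a. l < b ^ a)"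
  have 1: "l < b ^ a" unfolding a_def using * by (rule LeastI)
  hence 2: "1 \<le> a" using assms(2) by (cases a) auto
  have "\<not> l < b ^ (a - 1)" using 2 unfolding a_def by (intro not_less_Least) auto
  hence 3: "b ^ (a - 1) \<le> l" by simp
  have "num_digits b l = a" using assms(1) 2 3 1 by (rule num_digits_eqI)
  with 1 2 3 show "1 \<le> num_digits b l" "b ^ (num_digits b l - 1) \<le> l" "l < b ^ num_digits b l"
    by auto
qed

lemma r_weight_nonneg: "0 \<le> r_weight b \<alpha> d l"
  by (simp add: r_weight_def)

lemma r_weight_le:
  assumes "2 \<le> b" "1 \<le> \<alpha>" "1 \<le> d" "1 \<le> l"
  shows "r_weight b \<alpha> d l \<le> 1 / real l ^ 2"
proof -
  let ?a = "num_digits b l"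
  have a: "l < b ^ ?a" using num_digits_bounds assms by blast
  have "- 2 * int (min \<alpha> d) * int ?a \<le> - 2 * int ?a"
    using mult_right_mono[of 1 "int (min \<alpha> d)" "int ?a"] assms by auto
  hence "r_weight b \<alpha> d l \<le> real b powi (- 2 * int ?a)"
    using assms by (auto simp: r_weight_def intro!: power_int_increasing)
  also have "\<dots> = 1 / (real (b ^ ?a))\<^sup>2"
  proof -
    have "real b powi (- 2 * int ?a) = inverse (real b powi (int (2 * ?a)))"
      by (simp add: power_int_minus[symmetric])
    also have "\<dots> = inverse (real b ^ (2 * ?a))" by (simp only: power_int_of_nat)
    finally show ?thesis by (simp add: power_mult[symmetric] mult.commute inverse_eq_divide)
  qed
  also have "\<dots> \<le> 1 / real l ^ 2"
    using a assms by (intro divide_left_mono power_mono) auto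
  finally show ?thesis .
qed

text \<open>The infinite sums in \<^const>\<open>B_crit\<close> converge, so \<^const>\<open>infsum\<close> has no default value there.\<close>

lemma r_weight_prod_summable:
  assumes b: "2 \<le> b" "1 \<le> \<alpha>" "1 \<le> d" and w: "finite w"
    and L: "L \<subseteq> w \<rightarrow>\<^sub>E {1..}"
  shows "(\<lambda>l. \<Prod>j\<in>w. r_weight b \<alpha> d (l j)) summable_on L"
proof (rule nonneg_bdd_above_summable_on)
  define S where "S = (\<Sum>n. 1 / real n ^ 2)"
  have sm: "summable (\<lambda>n. 1 / real n ^ 2)"
    using inverse_power_summable[of 2, where 'a = real] by (simp add: inverse_eq_divide)
  have S: "(\<Sum>n=1..N. r_weight b \<alpha> d n) \<le> S" for N
  proof -
    have "(\<Sum>n=1..N. r_weight b \<alpha> d n) \<le> (\<Sum>n=1..N. 1 / real n ^ 2)"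
      using b by (intro sum_mono r_weight_le) auto
    also have "\<dots> \<le> S" unfolding S_def by (intro sum_le_suminf sm) auto
    finally show ?thesis .
  qed
  show "bdd_above (sum (\<lambda>l. \<Prod>j\<in>w. r_weight b \<alpha> d (l j)) ` {F. F \<subseteq> L \<and> finite F})"
  proof (rule bdd_aboveI2)
    fix F assume "F \<in> {F. F \<subseteq> L \<and> finite F}"
    hence F: "F \<subseteq> w \<rightarrow>\<^sub>E {1..}" "finite F" using L by auto
    define N where "N = Max (insert 0 ((\<lambda>(l, j). l j) ` (F \<times> w)))"
    have N: "l j \<le> N" if "l \<in> F" "j \<in> w" for l j
    proof -
      have "l j \<in> (\<lambda>(l, j). l j) ` (F \<times> w)" using that by (intro image_eqI[of _ _ "(l, j)"]) auto
      thus ?thesis unfolding N_def using F w by (intro Max_ge) auto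
    qed
    have FN: "F \<subseteq> w \<rightarrow>\<^sub>E {1..N}"
    proof
      fix l assume l: "l \<in> F"
      with F(1) have "l \<in> w \<rightarrow>\<^sub>E {1..}" by blast
      with N[OF l] show "l \<in> w \<rightarrow>\<^sub>E {1..N}" by (simp add: PiE_iff)
    qed
    have "(\<Sum>l\<in>F. \<Prod>j\<in>w. r_weight b \<alpha> d (l j))
            \<le> (\<Sum>l\<in>w \<rightarrow>\<^sub>E {1..N}. \<Prod>j\<in>w. r_weight b \<alpha> d (l j))"
      using FN w by (intro sum_mono2 finite_PiE prod_nonneg) (auto simp: r_weight_nonneg)
    also have "\<dots> = (\<Prod>j\<in>w. \<Sum>n=1..N. r_weight b \<alpha> d n)"
      using w by (subst prod_sum_PiE) auto
    also have "\<dots> \<le> S ^ card w"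
      using S by (auto intro!: power_mono sum_nonneg r_weight_nonneg)
    finally show "(\<Sum>l\<in>F. \<Prod>j\<in>w. r_weight b \<alpha> d (l j)) \<le> S ^ card w" .
  qed
qed (auto intro: prod_nonneg r_weight_nonneg)

end

theory Submission
  imports Defs
begin

text \<open>
  Write \<open>[k \<in> D\<^sup>\<bottom>]\<close> as the average over \<open>n\<close> of the product of the Walsh functions \<open>wal\<^sub>k\<^sub>j\<close>
  at the components \<open>y\<^sub>n\<^sub>,\<^sub>j\<close>: the digit-wise inner products add up to the coefficient of \<open>1/x\<close> in
  \<open>n(x) h(x) / p(x)\<close> with \<open>h = \<Sum> tr\<^sub>m(k\<^sub>j) q\<^sub>j\<close>, and this linear form in the digits of \<open>n\<close> vanishes
  identically iff \<open>p\<close> divides \<open>h\<close>. The inner sums of the criterion then factor into one-dimensional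
  series \<open>\<Sum> r(l) wal\<^sub>l(y)\<close> over \<open>l \<ge> 1\<close>. The weight \<open>r\<close> depends only on the number of digits of \<open>l\<close>,
  and the Walsh functions with \<open>l < b\<^sup>a\<close> sum to \<open>b\<^sup>a\<close> if the first \<open>a\<close> digits of \<open>y\<close> vanish and to
  \<open>0\<close> otherwise, so the series is geometric up to the first nonzero digit and equals \<open>\<chi>(y)\<close>.
  Finally a subset \<open>w\<close> with \<open>\<phi>(w) = u\<close> is a choice of a nonempty subset of each block in \<open>u\<close>.
\<close>

section \<open>Characters and Walsh functions\<close>

text \<open>The canonical additive character of the prime field, with values in the b-th roots of
  unity.\<close>

definition add_char :: "'p::prime_card mod_ring \<Rightarrow> complex" where
  "add_char x = cis (2 * pi * real_of_int (to_int_mod_ring x) / real CARD('p))"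

lemma card_ge_2: "2 \<le> CARD('p::prime_card)"
  using prime_card[where 'a = 'p] by (rule prime_ge_2_nat)

lemma to_int_mod_ring_bounds:
  "0 \<le> to_int_mod_ring x" "to_int_mod_ring x < int CARD('p)" for x :: "'p::prime_card mod_ring"
  using range_to_int_mod_ring[where 'a = 'p] rangeI[of to_int_mod_ring x] by auto

lemma add_char_0 [simp]: "add_char 0 = 1"
  by (simp add: add_char_def)

lemma norm_add_char [simp]: "norm (add_char x) = 1"
  by (simp add: add_char_def)

text \<open>Addition in the field reduces the sum of the representatives modulo b, and what is
  removed is a whole number of turns of the circle.\<close>

lemma add_char_add: "add_char (x + y) = add_char x * add_char y"
  for x y :: "'p::prime_card mod_ring"
proof -
  define n where "n = int CARD('p)"
  define a where "a = to_int_mod_ring x + to_int_mod_ring y"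
  have n: "n \<noteq> 0" by (simp add: n_def)
  have *: "real_of_int a = real_of_int (a mod n) + real_of_int n * real_of_int (a div n)"
    by (simp flip: of_int_mult of_int_add)
  have "2 * pi * real_of_int (a mod n) / real_of_int n
           = 2 * pi * real_of_int a / real_of_int n + 2 * pi * real_of_int (- (a div n))"
    using n by (subst *) (simp add: field_simps)
  hence "cis (2 * pi * real_of_int (a mod n) / real_of_int n)
           = cis (2 * pi * real_of_int a / real_of_int n)"
    by (simp only: cis_mult[symmetric] cis_multiple_2pi Ints_of_int mult_1_right)
  thus ?thesis
    by (simp add: add_char_def to_int_mod_ring_add a_def n_def cis_mult add_divide_distrib ring_distribs)
qed

lemma add_char_sum: "add_char (sum f A) = (\<Prod>i\<in>A. add_char (f i))"
  by (induction A rule: infinite_finite_induct) (auto simp: add_char_add)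

lemma add_char_of_nat_mult: "add_char (of_nat c * x) = add_char x ^ c"
  by (induction c) (auto simp: add_char_add ring_distribs)

lemma add_char_eq_1_iff: "add_char x = 1 \<longleftrightarrow> x = 0"
  for x :: "'p::prime_card mod_ring"
proof
  assume "add_char x = 1"
  define a where "a = to_int_mod_ring x"
  define n where "n = int CARD('p)"
  have a: "0 \<le> a" "a < n" using to_int_mod_ring_bounds[of x] by (auto simp: a_def n_def)
  have "cos (2 * pi * real_of_int a / real_of_int n) = 1"
    using arg_cong[OF \<open>add_char x = 1\<close>, of Re] by (simp add: add_char_def a_def n_def)
  then obtain k :: int where "2 * pi * real_of_int a / real_of_int n = real_of_int k * 2 * pi"
    by (auto simp: cos_one_2pi_int)
  hence "real_of_int a = real_of_int (k * n)" using a by (simp add: field_simps)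
  hence "a = k * n" by linarith
  with a have "a = 0" by (metis mod_mult_self2_is_0 mod_pos_pos_trivial)
  thus "x = 0" by (simp add: a_def)
qed simp

lemma sum_add_char:
  "(\<Sum>c<CARD('p). add_char (of_nat c * x)) = (if x = 0 then of_nat CARD('p) else 0)"
  for x :: "'p::prime_card mod_ring"
proof (cases "x = 0")
  case False
  \<comment> \<open>\<open>of_nat CARD('p)\<close> is 0 in the field, so \<open>add_char x\<close>
    is a b-th root of unity; being different from 1, it makes the geometric sum vanish.\<close>
  have "add_char x ^ CARD('p) = 1"
    using add_char_of_nat_mult[of "CARD('p)" x] by simp
  thus ?thesis using False by (simp add: add_char_of_nat_mult geometric_sum add_char_eq_1_iff)
qed simp

text \<open>The Walsh function of index l, taking the base-b digits of its argument instead of the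
  real number: \<open>t i\<close> is the digit at b^(-(i+1)), and only the first \<open>m\<close>
  digits count.\<close>

definition walsh :: "nat \<Rightarrow> (nat \<Rightarrow> 'p::prime_card mod_ring) \<Rightarrow> nat \<Rightarrow> complex" where
  "walsh m t l = (\<Prod>i<m. add_char (of_nat (l div CARD('p) ^ i mod CARD('p)) * t i))"

lemma norm_walsh [simp]: "norm (walsh m t l) = 1"
  by (simp add: walsh_def prod_norm[symmetric])

lemma walsh_0_right [simp]: "walsh m t 0 = 1"
  by (simp add: walsh_def)

lemma walsh_Suc:
  fixes t :: "nat \<Rightarrow> 'p::prime_card mod_ring"
  assumes "c < CARD('p)"
  shows "walsh (Suc m) t (c + l * CARD('p)) = add_char (of_nat c * t 0) * walsh m (t \<circ> Suc) l"
  using assms unfolding walsh_def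
  by (subst prod.lessThan_Suc_shift) (simp add: div_mult2_eq)

text \<open>Splitting off the lowest digit of \<open>l\<close> gives a full character sum at
  \<open>t 0\<close> times the same sum for the shifted sequence. The minimum with \<open>m\<close>
  appears because \<open>walsh m\<close> ignores the digits of \<open>l\<close> from position
  \<open>m\<close> on.\<close>

lemma sum_walsh:
  "(\<Sum>l<CARD('p) ^ a. walsh m t l) = (if \<forall>i<min a m. t i = 0 then of_nat CARD('p) ^ a else 0)"
  for t :: "nat \<Rightarrow> 'p::prime_card mod_ring"
proof (induction a arbitrary: m t)
  case (Suc a)
  show ?case
  proof (cases m)
    case 0
    thus ?thesis by (simp add: walsh_def)
  next
    case (Suc k)
    have "(\<Sum>l<CARD('p) ^ Suc a. walsh m t l)
            = (\<Sum>l<CARD('p) ^ a. \<Sum>i\<in>{l * CARD('p)..<l * CARD('p) + CARD('p)}. walsh m t i)"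
      by (simp add: sum.nat_group mult.commute)
    also have "\<dots> = (\<Sum>l<CARD('p) ^ a. \<Sum>c<CARD('p). walsh m t (c + l * CARD('p)))"
        by (simp add: sum.atLeastLessThan_shift_0[of _ "_ * _"] lessThan_atLeast0 add.commute)
    also have "\<dots> = (\<Sum>l<CARD('p) ^ a. \<Sum>c<CARD('p).
                        add_char (of_nat c * t 0) * walsh k (t \<circ> Suc) l)"
      by (intro sum.cong refl) (simp only: \<open>m = Suc k\<close> walsh_Suc lessThan_iff)
    also have "\<dots> = (\<Sum>c<CARD('p). add_char (of_nat c * t 0))
                     * (\<Sum>l<CARD('p) ^ a. walsh k (t \<circ> Suc) l)"
      by (subst sum.swap) (simp add: sum_product)
    also have "\<dots> = (if \<forall>i<min (Suc a) m. t i = 0 then of_nat CARD('p) ^ Suc a else 0)"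
      by (simp only: sum_add_char Suc.IH) (auto simp: \<open>m = Suc k\<close> less_Suc_eq_0_disj)
    finally show ?thesis .
  qed
qed simp

section \<open>Real values of digit sequences\<close>

definition digit_val :: "nat \<Rightarrow> (nat \<Rightarrow> 'p::prime_card mod_ring) \<Rightarrow> real" where
  "digit_val m t = (\<Sum>i<m. real_of_int (to_int_mod_ring (t i)) / real CARD('p) ^ Suc i)"

text \<open>The extreme case has all digits from \<open>k\<close> on equal to b - 1, a telescoping
  sum. The subtracted term makes the bound by b^(-k) strict, as the floor of the logarithm
  requires.\<close>

lemma digit_val_upper:
  fixes t :: "nat \<Rightarrow> 'p::prime_card mod_ring"
  assumes "k \<le> m" "\<forall>i<k. t i = 0"
  shows "digit_val m t \<le> 1 / real CARD('p) ^ k - 1 / real CARD('p) ^ m"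
  using assms(1)
proof (induction m rule: dec_induct)
  case base
  thus ?case using assms by (simp add: digit_val_def)
next
  case (step m)
  have "real_of_int (to_int_mod_ring (t m)) \<le> real CARD('p) - 1"
    using to_int_mod_ring_bounds[of "t m"] by linarith
  hence "real_of_int (to_int_mod_ring (t m)) / real CARD('p) ^ Suc m
           \<le> (real CARD('p) - 1) / real CARD('p) ^ Suc m"
    by (intro divide_right_mono) auto
  also have "\<dots> = 1 / real CARD('p) ^ m - 1 / real CARD('p) ^ Suc m"
    by (simp add: field_simps)
  finally show ?case using step by (simp add: digit_val_def)
qed

lemma digit_val_lower:
  fixes t :: "nat \<Rightarrow> 'p::prime_card mod_ring"
  assumes "k < m" "t k \<noteq> 0"
  shows "1 / real CARD('p) ^ Suc k \<le> digit_val m t"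
proof -
  have "to_int_mod_ring (t k) \<noteq> 0" using assms by simp
  hence "1 \<le> real_of_int (to_int_mod_ring (t k))"
    using to_int_mod_ring_bounds[of "t k"] by linarith
  hence "1 / real CARD('p) ^ Suc k \<le> real_of_int (to_int_mod_ring (t k)) / real CARD('p) ^ Suc k"
    by (intro divide_right_mono) auto
  also have "\<dots> \<le> digit_val m t"
    unfolding digit_val_def using assms to_int_mod_ring_bounds(1)[where 'p = 'p]
    by (intro member_le_sum) (auto intro!: divide_nonneg_nonneg)
  finally show ?thesis .
qed

text \<open>With the first nonzero digit at index \<open>k\<close> the value lies in [b^(-(k+1)),
  b^(-k)). This turns the logarithm in \<open>chi\<close> into a digit position.\<close>

lemma floor_log_digit_val:
  fixes t :: "nat \<Rightarrow> 'p::prime_card mod_ring"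
  assumes "k < m" "t k \<noteq> 0" "\<forall>i<k. t i = 0"
  shows "\<lfloor>log (real CARD('p)) (digit_val m t)\<rfloor> = - int (Suc k)"
proof -
  let ?b = "real CARD('p)"
  have b: "1 < ?b" using card_ge_2[where 'p = 'p] by linarith
  have *: "1 / ?b ^ Suc k \<le> digit_val m t" using assms by (intro digit_val_lower) auto
  have "digit_val m t \<le> 1 / ?b ^ k - 1 / ?b ^ m" using assms by (intro digit_val_upper) auto
  hence **: "digit_val m t < 1 / ?b ^ k" using b by (smt (verit) divide_pos_pos zero_less_power)
  have pos: "digit_val m t > 0" using * b by (smt (verit) divide_pos_pos zero_less_power)
  have powr: "?b powr (- real n) = 1 / ?b ^ n" for n
    using b by (simp only: powr_minus_divide powr_realpow)
  show ?thesis
  proof (rule floor_unique)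
    show "real_of_int (- int (Suc k)) \<le> log ?b (digit_val m t)"
      using b pos * powr[of "Suc k"] by (subst le_log_iff) (auto simp del: power_Suc of_nat_Suc)
    have "log ?b (digit_val m t) < - real k"
      using b pos ** powr[of k] by (subst log_less_iff) auto
    thus "log ?b (digit_val m t) < real_of_int (- int (Suc k)) + 1" by simp
  qed
qed

section \<open>Walsh series of the weights\<close>

lemma sum_powers_Suc:
  fixes f :: "nat \<Rightarrow> 'a::ab_group_add"
  assumes "1 \<le> b"
  shows "(\<Sum>l\<in>{b ^ A..<b ^ Suc A}. f l) = (\<Sum>l<b ^ Suc A. f l) - (\<Sum>l<b ^ A. f l)"
  using assms sum.atLeastLessThan_concat[of 0 "b ^ A" "b ^ Suc A" f]
  by (simp add: lessThan_atLeast0 eq_diff_eq add.commute)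

lemma r_weight_eq:
  assumes "2 \<le> b" "b ^ a \<le> l" "l < b ^ Suc a"
  shows "r_weight b \<alpha> d l = 1 / ((real b ^ (2 * min \<alpha> d)) ^ Suc a * real b ^ \<alpha>)"
proof -
  have "num_digits b l = Suc a" using assms by (intro num_digits_eqI) auto
  moreover have "l \<noteq> 0" using assms by (cases "l = 0") auto
  moreover have "- 2 * int (min \<alpha> d) * int (Suc a) - int \<alpha> = - int (2 * min \<alpha> d * Suc a + \<alpha>)"
    by (simp add: algebra_simps)
  ultimately show ?thesis
    unfolding r_weight_def
    by (simp only: power_int_minus power_int_of_nat power_add power_mult inverse_eq_divide if_False)
qed

text \<open>Keeps the denominator of \<open>chi\<close> nonzero and the ratio of the geometric
  series below 1.\<close>

lemma card_less_card_power:
  assumes "1 \<le> k"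
  shows "real CARD('p::prime_card) < real CARD('p) ^ (2 * k)"
  using card_ge_2[where 'p = 'p] assms power_strict_increasing[of 1 "2 * k" "real CARD('p)"] by simp

text \<open>The terms of the series, not its sum. The index 0 is included and contributes 1, so that
  sums over all l < b^A can be used.\<close>

definition walsh_series ::
  "nat \<Rightarrow> nat \<Rightarrow> nat \<Rightarrow> (nat \<Rightarrow> 'p::prime_card mod_ring) \<Rightarrow> nat \<Rightarrow> complex" where
  "walsh_series m \<alpha> d t l = of_real (r_weight CARD('p) \<alpha> d l) * walsh m t l"

lemma norm_walsh_series:
  "norm (walsh_series m \<alpha> d t l) = r_weight CARD('p) \<alpha> d l" for t :: "nat \<Rightarrow> 'p::prime_card mod_ring"
  by (simp add: walsh_series_def norm_mult r_weight_nonneg)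

lemma summable_norm_walsh_series:
  fixes t :: "nat \<Rightarrow> 'p::prime_card mod_ring"
  assumes "1 \<le> \<alpha>" "1 \<le> d"
  shows "summable (\<lambda>l. norm (walsh_series m \<alpha> d t l))"
proof (rule summable_comparison_test)
  show "\<exists>N. \<forall>l\<ge>N. norm (norm (walsh_series m \<alpha> d t l)) \<le> 1 / real l ^ 2"
    using assms card_ge_2[where 'p = 'p]
    by (intro exI[of _ 1] allI impI) (simp add: norm_walsh_series r_weight_nonneg r_weight_le)
  show "summable (\<lambda>n. 1 / real n ^ 2)"
    using inverse_power_summable[of 2, where 'a = real] by (simp add: inverse_eq_divide)
qed

text \<open>The weight is constant on the integers with \<open>Suc A\<close> digits, so their share
  is a difference of two Walsh sums times that constant.\<close>

lemma sum_walsh_series_Suc: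
  fixes t :: "nat \<Rightarrow> 'p::prime_card mod_ring"
  shows "(\<Sum>l<CARD('p) ^ Suc A. walsh_series m \<alpha> d t l) = (\<Sum>l<CARD('p) ^ A. walsh_series m \<alpha> d t l)
           + ((\<Sum>l<CARD('p) ^ Suc A. walsh m t l) - (\<Sum>l<CARD('p) ^ A. walsh m t l))
             / of_real ((real CARD('p) ^ (2 * min \<alpha> d)) ^ Suc A * real CARD('p) ^ \<alpha>)"
proof -
  define R where "R = (real CARD('p) ^ (2 * min \<alpha> d)) ^ Suc A * real CARD('p) ^ \<alpha>"
  have b: "1 \<le> CARD('p)" using card_ge_2[where 'p = 'p] by simp
  have "(\<Sum>l\<in>{CARD('p) ^ A..<CARD('p) ^ Suc A}. walsh_series m \<alpha> d t l)
          = (\<Sum>l\<in>{CARD('p) ^ A..<CARD('p) ^ Suc A}. walsh m t l / of_real R)"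
    by (intro sum.cong refl)
       (simp add: walsh_series_def r_weight_eq[OF card_ge_2, of A] R_def del: power_Suc of_real_mult)
  also have "\<dots> = (\<Sum>l\<in>{CARD('p) ^ A..<CARD('p) ^ Suc A}. walsh m t l) / of_real R"
    by (simp add: sum_divide_distrib)
  finally show ?thesis unfolding sum_powers_Suc[OF b] R_def[symmetric] by (simp add: algebra_simps)
qed

text \<open>While no nonzero digit has been met, the Walsh sums are full powers of b and the
  integers with a + 1 digits contribute (b - 1) b^a / (N^(a+1) b^\<alpha>), a geometric progression
  with ratio b / N.\<close>

lemma sum_walsh_series_zero_digits:
  fixes t :: "nat \<Rightarrow> 'p::prime_card mod_ring"
  assumes "\<forall>i<min A m. t i = 0" and "1 \<le> min \<alpha> d"
  defines "N \<equiv> real CARD('p) ^ (2 * min \<alpha> d)"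
  shows "(\<Sum>l<CARD('p) ^ A. walsh_series m \<alpha> d t l) =
           of_real (1 + (real CARD('p) - 1) / (N - real CARD('p))
                          * (1 - (real CARD('p) / N) ^ A) / real CARD('p) ^ \<alpha>)"
  using assms(1)
proof (induction A)
  case 0
  show ?case by (simp add: walsh_series_def r_weight_def)
next
  case (Suc A)
  let ?B = "real CARD('p)"
  have N: "?B < N" "0 < ?B" unfolding N_def by (rule card_less_card_power[OF assms(2)]) simp
  have zero: "\<forall>i<min A m. t i = 0" using Suc.prems by simp
  have "(?B ^ Suc A - ?B ^ A) / (N ^ Suc A * ?B ^ \<alpha>)
          = (?B - 1) / (N - ?B) * ((?B / N) ^ A - (?B / N) ^ Suc A) / ?B ^ \<alpha>"
  proof -
    have "(?B - 1) / (N - ?B) * ((?B / N) ^ A - (?B / N) ^ Suc A)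
            = (?B - 1) / (N - ?B) * ((?B / N) ^ A * ((N - ?B) / N))"
      using N by (simp add: field_simps)
    also have "\<dots> = (?B - 1) * (?B / N) ^ A / N" using N by simp
    also have "\<dots> = (?B ^ Suc A - ?B ^ A) / N ^ Suc A"
      by (simp add: power_divide algebra_simps)
    finally show ?thesis by simp
  qed
  hence *: "1 + (?B - 1) / (N - ?B) * (1 - (?B / N) ^ A) / ?B ^ \<alpha>
              + (?B ^ Suc A - ?B ^ A) / (N ^ Suc A * ?B ^ \<alpha>)
            = 1 + (?B - 1) / (N - ?B) * (1 - (?B / N) ^ Suc A) / ?B ^ \<alpha>"
    by (simp only: diff_divide_distrib right_diff_distrib)
  have W: "(\<Sum>l<CARD('p) ^ Suc A. walsh m t l) = of_real (?B ^ Suc A)"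
          "(\<Sum>l<CARD('p) ^ A. walsh m t l) = of_real (?B ^ A)"
    unfolding sum_walsh using Suc.prems zero by (auto simp del: power_Suc)
  show ?case
    unfolding sum_walsh_series_Suc W Suc.IH[OF zero] N_def[symmetric] *[symmetric]
    by (simp only: of_real_add of_real_diff of_real_divide)
qed

text \<open>At the first nonzero digit the Walsh sum drops from b^k to 0, giving one negative
  contribution; afterwards all Walsh sums vanish, so the partial sum is constant from
  \<open>Suc k\<close> on.\<close>

lemma sum_walsh_series_nonzero_digit:
  fixes t :: "nat \<Rightarrow> 'p::prime_card mod_ring"
  assumes "k < m" "t k \<noteq> 0" "\<forall>i<k. t i = 0" "Suc k \<le> A" "1 \<le> min \<alpha> d"
  defines "N \<equiv> real CARD('p) ^ (2 * min \<alpha> d)"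
  shows "(\<Sum>l<CARD('p) ^ A. walsh_series m \<alpha> d t l) =
           of_real (1 + (real CARD('p) - 1 - (real CARD('p) / N) ^ Suc k * (N - 1))
                         / (real CARD('p) ^ \<alpha> * (N - real CARD('p))))"
  using assms(4)
proof (induction A rule: dec_induct)
  case base
  let ?B = "real CARD('p)"
  have N: "?B < N" "0 < ?B" unfolding N_def by (rule card_less_card_power[OF assms(5)]) simp
  have "(?B - 1) / (N - ?B) * (1 - (?B / N) ^ k) - (?B / N) ^ k / N
          = (?B - 1 - (?B / N) ^ Suc k * (N - 1)) / (N - ?B)"
    using N by (simp add: field_simps)
  hence "((?B - 1) / (N - ?B) * (1 - (?B / N) ^ k) - (?B / N) ^ k / N) / ?B ^ \<alpha>
          = (?B - 1 - (?B / N) ^ Suc k * (N - 1)) / (?B ^ \<alpha> * (N - ?B))"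
    by (simp add: mult.commute)
  moreover have "(0 - ?B ^ k) / (N ^ Suc k * ?B ^ \<alpha>) = - ((?B / N) ^ k / N / ?B ^ \<alpha>)"
    by (simp add: power_divide mult_ac)
  ultimately have *: "1 + (?B - 1) / (N - ?B) * (1 - (?B / N) ^ k) / ?B ^ \<alpha>
              + (0 - ?B ^ k) / (N ^ Suc k * ?B ^ \<alpha>)
            = 1 + (?B - 1 - (?B / N) ^ Suc k * (N - 1)) / (?B ^ \<alpha> * (N - ?B))"
    by (simp add: diff_divide_distrib)
  have "\<forall>i<min k m. t i = 0" using assms by simp
  note IH = sum_walsh_series_zero_digits[OF this assms(5), folded N_def]
  have "\<not> (\<forall>i<min (Suc k) m. t i = 0)" using assms by auto
  hence W: "(\<Sum>l<CARD('p) ^ Suc k. walsh m t l) = of_real 0"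
           "(\<Sum>l<CARD('p) ^ k. walsh m t l) = of_real (?B ^ k)"
    unfolding sum_walsh using \<open>\<forall>i<min k m. t i = 0\<close> by (auto simp del: power_Suc)
  show ?case
    unfolding sum_walsh_series_Suc W IH N_def[symmetric] *[symmetric]
    by (simp only: of_real_add of_real_diff of_real_divide)
next
  case (step A)
  have "k < min A m" "k < min (Suc A) m" using step.hyps assms by auto
  hence "\<not> (\<forall>i<min A m. t i = 0)" "\<not> (\<forall>i<min (Suc A) m. t i = 0)"
    using assms(2) by blast+
  thus ?case unfolding sum_walsh_series_Suc sum_walsh using step.IH by (simp del: power_Suc)
qed

lemma sums_walsh_series:
  fixes t :: "nat \<Rightarrow> 'p::prime_card mod_ring"
  assumes "1 \<le> min \<alpha> d"
  shows "walsh_series m \<alpha> d t sums of_real (1 + chi CARD('p) \<alpha> d (digit_val m t))"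
proof -
  let ?B = "real CARD('p)"
  let ?v = "of_real (1 + chi CARD('p) \<alpha> d (digit_val m t)) :: complex"
  define N where "N = ?B ^ (2 * min \<alpha> d)"
  have N: "?B < N" "0 < ?B" unfolding N_def by (rule card_less_card_power[OF assms]) simp
  have lim: "(\<lambda>A. \<Sum>l<CARD('p) ^ A. walsh_series m \<alpha> d t l) \<longlonglongrightarrow> ?v"
  proof (cases "\<forall>i<m. t i = 0")
    case True
    \<comment> \<open>By the convention for y = 0 the power term of \<open>chi\<close> is absent,
      which matches (b/N)^A tending to 0.\<close>
    hence "digit_val m t = 0" by (simp add: digit_val_def)
    hence v: "?v = of_real (1 + (?B - 1) / (N - ?B) * (1 - 0) / ?B ^ \<alpha>)"
      by (simp add: chi_def N_def mult.commute)
    have "\<forall>i<min A m. t i = 0" for A using True by simp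
    note S = sum_walsh_series_zero_digits[OF this assms, folded N_def]
    have lim0: "(\<lambda>A. (?B / N) ^ A) \<longlonglongrightarrow> 0" using N by (intro LIMSEQ_power_zero) auto
    show ?thesis unfolding S v by (intro tendsto_intros lim0) auto
  next
    case False
    define k where "k = (LEAST i. i < m \<and> t i \<noteq> 0)"
    have k: "k < m" "t k \<noteq> 0" using LeastI_ex[of "\<lambda>i. i < m \<and> t i \<noteq> 0"] False by (auto simp: k_def)
    have k0: "\<forall>i<k. t i = 0"
    proof (intro allI impI)
      fix i assume "i < k"
      with not_less_Least[of i "\<lambda>i. i < m \<and> t i \<noteq> 0"] k(1) show "t i = 0" by (simp add: k_def)
    qed
    have "0 < 1 / ?B ^ Suc k" by simp
    also have "\<dots> \<le> digit_val m t" using k by (rule digit_val_lower)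
    finally have y: "digit_val m t \<noteq> 0" by simp
    \<comment> \<open>The floor is -(k+1), and b^(2 min(\<alpha>, d) - 1) = N / b, so the power in
      \<open>chi\<close> becomes (b/N)^(k+1).\<close>
    have "(2 * int (min \<alpha> d) - 1) * \<lfloor>log ?B (digit_val m t)\<rfloor> = - int ((2 * min \<alpha> d - 1) * Suc k)"
    proof -
      have "2 * int (min \<alpha> d) - 1 = int (2 * min \<alpha> d - 1)" using assms by (simp add: of_nat_diff)
      thus ?thesis by (simp only: floor_log_digit_val[OF k k0] of_nat_mult mult_minus_right)
    qed
    hence "?B powi ((2 * int (min \<alpha> d) - 1) * \<lfloor>log ?B (digit_val m t)\<rfloor>)
             = inverse (?B powi int ((2 * min \<alpha> d - 1) * Suc k))"
      by (simp only: power_int_minus)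
    also have "\<dots> = inverse (?B ^ (2 * min \<alpha> d - 1)) ^ Suc k"
      by (simp only: power_int_of_nat power_mult power_inverse)
    also have "inverse (?B ^ (2 * min \<alpha> d - 1)) = ?B / N"
    proof -
      have "N = ?B * ?B ^ (2 * min \<alpha> d - 1)"
        unfolding N_def using assms by (subst power_Suc[symmetric]) simp
      thus ?thesis by (simp add: inverse_eq_divide)
    qed
    finally have v: "?v = of_real (1 + (?B - 1 - (?B / N) ^ Suc k * (N - 1)) / (?B ^ \<alpha> * (N - ?B)))"
      using y by (simp only: chi_def N_def if_False)
    have "eventually (\<lambda>A. (\<Sum>l<CARD('p) ^ A. walsh_series m \<alpha> d t l) = ?v) sequentially"
      using eventually_ge_at_top[of "Suc k"]
      by eventually_elim
         (unfold v, rule sum_walsh_series_nonzero_digit[OF k k0 _ assms, folded N_def])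
    thus ?thesis by (rule tendsto_eventually)
  qed
  \<comment> \<open>Only partial sums with b^A terms are known. Summability gives the series a sum,
    and this subsequence determines it.\<close>
  have "summable (\<lambda>l. norm (walsh_series m \<alpha> d t l))"
    using assms by (intro summable_norm_walsh_series) auto
  hence S: "walsh_series m \<alpha> d t sums suminf (walsh_series m \<alpha> d t)"
    by (rule summable_norm_cancel[THEN summable_sums])
  have "strict_mono (\<lambda>A. CARD('p) ^ A)"
  proof (rule strict_monoI)
    show "CARD('p) ^ x < CARD('p) ^ y" if "x < y" for x y
      using that card_ge_2[where 'p = 'p] by (intro power_strict_increasing) linarith+
  qed
  hence "filterlim (\<lambda>A. CARD('p) ^ A) sequentially sequentially"
    by (rule filterlim_subseq)
  from filterlim_compose[OF S[unfolded sums_def] this]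
  have "(\<lambda>A. \<Sum>l<CARD('p) ^ A. walsh_series m \<alpha> d t l) \<longlonglongrightarrow> suminf (walsh_series m \<alpha> d t)" .
  hence "suminf (walsh_series m \<alpha> d t) = ?v" using lim by (rule LIMSEQ_unique)
  with S show ?thesis by simp
qed

text \<open>The term at index 0 equals 1; removing it removes the 1 in front of
  \<open>chi\<close>.\<close>

lemma has_sum_walsh_series:
  fixes t :: "nat \<Rightarrow> 'p::prime_card mod_ring"
  assumes "1 \<le> \<alpha>" "1 \<le> d"
  shows "(walsh_series m \<alpha> d t has_sum of_real (chi CARD('p) \<alpha> d (digit_val m t))) {1..}"
proof -
  have "(walsh_series m \<alpha> d t has_sum of_real (1 + chi CARD('p) \<alpha> d (digit_val m t))) UNIV"
    using assms by (intro norm_summable_imp_has_sum summable_norm_walsh_series sums_walsh_series) auto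
  moreover have "(walsh_series m \<alpha> d t has_sum 1) {0}"
    using has_sum_finite[of "{0}" "walsh_series m \<alpha> d t"] by (simp add: walsh_series_def r_weight_def)
  ultimately have "(walsh_series m \<alpha> d t has_sum
      (of_real (1 + chi CARD('p) \<alpha> d (digit_val m t)) - 1)) (UNIV - {0})"
    by (rule has_sum_Diff) auto
  moreover have "UNIV - {0} = {1::nat..}" by auto
  ultimately show ?thesis by simp
qed

text \<open>The norms of the products are products of weights, hence summable; absolute convergence
  lets the sum over vectors split into a product of one-dimensional sums.\<close>

lemma has_sum_prod_walsh_series:
  fixes t :: "nat \<Rightarrow> nat \<Rightarrow> 'p::prime_card mod_ring"
  assumes "1 \<le> \<alpha>" "1 \<le> d" "finite w"
  shows "((\<lambda>l. \<Prod>j\<in>w. walsh_series m \<alpha> d (t j) (l j)) has_sum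
           of_real (\<Prod>j\<in>w. chi CARD('p) \<alpha> d (digit_val m (t j)))) (w \<rightarrow>\<^sub>E {1..})"
proof -
  let ?f = "\<lambda>j. walsh_series m \<alpha> d (t j)"
  have "(\<lambda>l. norm (\<Prod>j\<in>w. ?f j (l j))) summable_on (w \<rightarrow>\<^sub>E {1..})"
    using r_weight_prod_summable[OF card_ge_2 assms order_refl]
    by (simp add: prod_norm[symmetric] norm_walsh_series)
  hence "(\<lambda>l. \<Prod>j\<in>w. ?f j (l j)) summable_on (w \<rightarrow>\<^sub>E {1..})"
    by (rule abs_summable_summable)
  moreover have "infsum (\<lambda>l. \<Prod>j\<in>w. ?f j (l j)) (w \<rightarrow>\<^sub>E {1..}) = (\<Prod>j\<in>w. infsum (?f j) {1..})"
  proof (rule infsum_prod_PiE)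
    show "?f j summable_on {1..}" for j
      using has_sum_walsh_series[OF assms(1,2)] by (rule has_sum_imp_summable)
  qed (use assms calculation in auto)
  moreover have "infsum (?f j) {1..} = of_real (chi CARD('p) \<alpha> d (digit_val m (t j)))" for j
    using has_sum_walsh_series[OF assms(1,2)] by (rule infsumI)
  ultimately show ?thesis by (simp add: summable_iff_has_sum_infsum)
qed

section \<open>Residues of quotients of polynomials\<close>

lemma poly_to_fls_nth:
  fixes f :: "'a::field poly"
  shows "fls_nth (poly_to_fls f) k = (if k \<le> 0 then Polynomial.coeff f (nat (- k)) else 0)"
proof -
  have nth_sum: "fls_nth (sum g A) k = (\<Sum>i\<in>A. fls_nth (g i) k)" for g :: "nat \<Rightarrow> 'a fls" and A
    by (induction A rule: infinite_finite_induct) auto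
  have "fls_nth (poly_to_fls f) k
          = (\<Sum>i\<le>degree f. Polynomial.coeff f i * (if k = - int i then 1 else 0))"
    by (simp add: poly_to_fls_def nth_sum)
  also have "\<dots> = (\<Sum>i\<le>degree f. if i = nat (- k) \<and> k \<le> 0 then Polynomial.coeff f i else 0)"
    by (intro sum.cong) auto
  also have "\<dots> = (if k \<le> 0 then Polynomial.coeff f (nat (- k)) else 0)"
    by (auto simp: coeff_eq_0)
  finally show ?thesis .
qed

lemma poly_to_fls_0 [simp]: "poly_to_fls 0 = 0"
  by (rule fls_eqI) (simp add: poly_to_fls_nth)

lemma poly_to_fls_add: "poly_to_fls (f + g) = poly_to_fls f + poly_to_fls g"
  by (rule fls_eqI) (simp add: poly_to_fls_nth)

lemma poly_to_fls_sum: "poly_to_fls (sum f A) = (\<Sum>i\<in>A. poly_to_fls (f i))"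
  by (induction A rule: infinite_finite_induct) (auto simp: poly_to_fls_add)

lemma poly_to_fls_monom: "poly_to_fls (Polynomial.monom c n) = fls_const c * fls_X_inv ^ n"
  by (rule fls_eqI) (auto simp: poly_to_fls_nth)

text \<open>Multiplying by a monomial is an index shift, and every polynomial is the sum of its
  monomials.\<close>

lemma poly_to_fls_mult: "poly_to_fls (f * g) = poly_to_fls f * poly_to_fls g"
proof -
  have *: "poly_to_fls (Polynomial.monom c n * g) = poly_to_fls (Polynomial.monom c n) * poly_to_fls g"
    for c n
  proof (rule fls_eqI)
    fix k
    have "poly_to_fls (Polynomial.monom c n) * poly_to_fls g
            = fls_const c * fls_shift (int n) (poly_to_fls g)"
      by (simp only: poly_to_fls_monom mult.assoc fls_X_inv_power_times_conv_shift(1))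
    moreover have "nat (- k) - n = nat (- k - int n)" by simp
    ultimately show "fls_nth (poly_to_fls (Polynomial.monom c n * g)) k
                 = fls_nth (poly_to_fls (Polynomial.monom c n) * poly_to_fls g) k"
      by (auto simp: poly_to_fls_nth coeff_monom_mult)
  qed
  have "poly_to_fls (f * g) = (\<Sum>i\<le>degree f. poly_to_fls (Polynomial.monom (Polynomial.coeff f i) i * g))"
    by (subst (1) poly_as_sum_of_monoms[symmetric]) (simp only: sum_distrib_right poly_to_fls_sum)
  also have "\<dots> = (\<Sum>i\<le>degree f. poly_to_fls (Polynomial.monom (Polynomial.coeff f i) i)) * poly_to_fls g"
    by (simp only: * sum_distrib_right)
  also have "\<dots> = poly_to_fls f * poly_to_fls g"
    by (simp only: poly_to_fls_sum[symmetric] poly_as_sum_of_monoms)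
  finally show ?thesis .
qed

lemma poly_to_fls_eq_0_iff [simp]: "poly_to_fls f = 0 \<longleftrightarrow> f = 0"
proof
  assume "poly_to_fls f = 0"
  hence "Polynomial.coeff f n = 0" for n
    using poly_to_fls_nth[of f "- int n"] by simp
  thus "f = 0" by (simp add: poly_eq_iff)
qed simp

lemma fls_subdegree_poly_to_fls: "fls_subdegree (poly_to_fls f) = - int (degree f)"
proof (cases "f = 0")
  case False
  thus ?thesis by (intro fls_subdegree_eqI) (auto simp: poly_to_fls_nth coeff_eq_0)
qed simp

text \<open>The coefficient of \<open>1 / x\<close> of \<open>f / p\<close>. Its linearity turns the digit-wise inner products
  below into a single residue.\<close>

definition res_quot :: "'a::field poly \<Rightarrow> 'a poly \<Rightarrow> 'a" where
  "res_quot p f = fls_nth (poly_to_fls f / poly_to_fls p) 1"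

lemma res_quot_add: "res_quot p (f + g) = res_quot p f + res_quot p g"
  by (simp add: res_quot_def poly_to_fls_add add_divide_distrib)

lemma res_quot_0 [simp]: "res_quot p 0 = 0"
  by (simp add: res_quot_def)

lemma res_quot_sum: "res_quot p (sum f A) = (\<Sum>i\<in>A. res_quot p (f i))"
  by (induction A rule: infinite_finite_induct) (auto simp: res_quot_add)

text \<open>Multiplying by x^i moves the coefficient of x^(-(i+1)) to x^(-1), so each digit of a
  quotient is a residue.\<close>

lemma res_quot_monom_mult:
  "res_quot p (Polynomial.monom c i * f)
     = c * fls_nth (poly_to_fls f / poly_to_fls p) (int i + 1)"
proof -
  have "poly_to_fls (Polynomial.monom c i * f) / poly_to_fls p
          = fls_const c * (fls_X_inv ^ i * (poly_to_fls f / poly_to_fls p))"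
    by (simp only: poly_to_fls_mult poly_to_fls_monom mult.assoc times_divide_eq_right)
  also have "\<dots> = fls_const c * fls_shift (int i) (poly_to_fls f / poly_to_fls p)"
    by (simp only: fls_X_inv_power_times_conv_shift(1))
  finally show ?thesis by (simp add: res_quot_def add.commute)
qed

lemma res_quot_multiple: "p \<noteq> 0 \<Longrightarrow> res_quot p (f * p) = 0"
  by (simp add: res_quot_def poly_to_fls_mult poly_to_fls_nth)

text \<open>The quotient starts exactly at x^(-1), so its residue is its leading
  coefficient.\<close>

lemma res_quot_nonzero:
  assumes "Suc (degree f) = degree p" "f \<noteq> 0"
  shows "res_quot p f \<noteq> 0"
proof -
  have p: "p \<noteq> 0" using assms by auto
  have *: "fls_subdegree (poly_to_fls f / poly_to_fls p) = 1"
    using assms p by (subst fls_divide_subdegree) (auto simp: fls_subdegree_poly_to_fls)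
  have "poly_to_fls f / poly_to_fls p \<noteq> 0" using assms p by simp
  from nth_fls_subdegree_nonzero[OF this] show ?thesis by (simp add: res_quot_def *)
qed

text \<open>A multiple of \<open>p\<close> has a polynomial quotient, which has no x^(-1) term.
  Conversely, a nonzero remainder modulo \<open>p\<close> can be shifted to degree
  \<open>degree p - 1\<close>, where its residue is nonzero.\<close>

lemma dvd_iff_res_quot:
  assumes "0 < degree p"
  shows "p dvd h \<longleftrightarrow> (\<forall>i<degree p. res_quot p (Polynomial.monom 1 i * h) = 0)"
proof
  have p: "p \<noteq> 0" using assms by auto
  assume "p dvd h"
  then obtain a where "h = p * a" by (rule dvdE)
  hence "Polynomial.monom 1 i * h = (Polynomial.monom 1 i * a) * p" for i by (simp add: mult_ac)
  thus "\<forall>i<degree p. res_quot p (Polynomial.monom 1 i * h) = 0"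
    by (simp only: res_quot_multiple[OF p] simp_thms)
next
  assume *: "\<forall>i<degree p. res_quot p (Polynomial.monom 1 i * h) = 0"
  have p: "p \<noteq> 0" using assms by auto
  show "p dvd h"
  proof (rule ccontr)
    assume "\<not> p dvd h"
    define r where "r = h mod p"
    have r: "r \<noteq> 0" using \<open>\<not> p dvd h\<close> by (auto simp: r_def mod_eq_0_iff_dvd)
    have deg: "degree r < degree p"
      unfolding r_def using degree_mod_less_degree[of p h] p \<open>\<not> p dvd h\<close> by auto
    \<comment> \<open>Chosen so that x^i r has degree one below that of \<open>p\<close>.\<close>
    define i where "i = degree p - 1 - degree r"
    have "h = (h div p) * p + r" by (simp add: r_def)
    hence "Polynomial.monom 1 i * h
             = (Polynomial.monom 1 i * (h div p)) * p + Polynomial.monom 1 i * r"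
      by (metis (no_types, lifting) distrib_left mult.assoc)
    hence "res_quot p (Polynomial.monom 1 i * h) = res_quot p (Polynomial.monom 1 i * r)"
      by (simp add: res_quot_add res_quot_multiple[OF p])
    moreover have "res_quot p (Polynomial.monom 1 i * r) \<noteq> 0"
      using r deg by (intro res_quot_nonzero) (auto simp: degree_mult_eq degree_monom_eq i_def monom_eq_0_iff)
    moreover have "i < degree p" using deg by (auto simp: i_def)
    ultimately show False using * by simp
  qed
qed

section \<open>Digit polynomials and their residues\<close>

lemma trunc_poly_0 [simp]: "trunc_poly m 0 = 0"
  by (simp add: trunc_poly_def)

lemma trunc_poly_eq:
  assumes "n < CARD('p) ^ m" "n < CARD('p) ^ k"
  shows "(trunc_poly m n :: 'p::prime_card mod_ring poly) = trunc_poly k n"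
proof -
  have *: "n div CARD('p) ^ i mod CARD('p) = 0" if "j \<le> i" "n < CARD('p) ^ j" for i j
    using that power_increasing[of j i "CARD('p)"] by (simp add: Suc_leI)
  have **: "(trunc_poly k n :: 'p mod_ring poly) = trunc_poly (max m k) n"
    if "n < CARD('p) ^ k" for m k
    unfolding trunc_poly_def using that *[of k] by (intro sum.mono_neutral_left) auto
  show ?thesis using **[of m k] **[of k m] assms by (simp add: max.commute)
qed

lemma nat_poly_eq_trunc_poly:
  assumes "n < CARD('p) ^ m"
  shows "(nat_poly n :: 'p::prime_card mod_ring poly) = trunc_poly m n"
proof -
  have "n < 2 ^ n" by (rule less_exp)
  also have "2 ^ n \<le> CARD('p) ^ n"
    using prime_card[where 'a = 'p] by (intro power_mono prime_ge_2_nat) auto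
  finally show ?thesis unfolding nat_poly_def by (intro trunc_poly_eq assms)
qed

text \<open>Reads the residue as the inner product of the digits of \<open>n\<close> with the
  Laurent coefficients of f/p, which is the exponent of a Walsh function.\<close>

lemma res_quot_trunc_poly_mult:
  "res_quot p (trunc_poly m n * f) =
     (\<Sum>i<m. of_nat (n div CARD('p) ^ i mod CARD('p))
             * fls_nth (poly_to_fls f / poly_to_fls p) (int i + 1))"
  for p :: "'p::prime_card mod_ring poly"
  by (simp add: trunc_poly_def sum_distrib_right res_quot_sum res_quot_monom_mult)

section \<open>Sums over subsets of blocks\<close>

lemma sum_prod_nonempty_subsets:
  fixes c :: "'b \<Rightarrow> 'c::comm_ring_1"
  assumes "finite A"
  shows "(\<Sum>v\<in>Pow A - {{}}. \<Prod>i\<in>v. c i) = - 1 + (\<Prod>i\<in>A. 1 + c i)"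
proof -
  have "(\<Prod>i\<in>A. 1 + c i) = (\<Sum>v\<in>Pow A. \<Prod>i\<in>v. c i)"
    using prod_add[OF assms, of c "\<lambda>_. 1"] by (simp add: add.commute)
  also have "\<dots> = 1 + (\<Sum>v\<in>Pow A - {{}}. \<Prod>i\<in>v. c i)"
    using assms by (subst sum.remove[of _ "{}"]) auto
  finally show ?thesis by simp
qed

text \<open>A union \<open>w\<close> of nonempty subsets of the \<open>B j\<close>, \<open>j \<in> u\<close>, is the same as the
  family of its traces \<open>w \<inter> B j\<close>.\<close>

lemma sum_prod_subsets_meeting:
  fixes c :: "'b \<Rightarrow> 'c::comm_ring_1"
  assumes fin: "finite S" "\<And>j. j \<in> S \<Longrightarrow> finite (B j)"
    and disj: "\<And>i j. i \<in> S \<Longrightarrow> j \<in> S \<Longrightarrow> i \<noteq> j \<Longrightarrow> B i \<inter> B j = {}"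
    and u: "u \<subseteq> S"
  shows "(\<Sum>w | w \<subseteq> (\<Union>j\<in>S. B j) \<and> {j \<in> S. w \<inter> B j \<noteq> {}} = u. \<Prod>i\<in>w. c i)
           = (\<Prod>j\<in>u. - 1 + (\<Prod>i\<in>B j. 1 + c i))"
proof -
  have fu: "finite u" using u fin(1) finite_subset by blast
  have fB: "finite (B j)" if "j \<in> u" for j using that u fin(2) by blast
  have disj': "i = j" if "x \<in> B i" "x \<in> B j" "i \<in> S" "j \<in> S" for i j x
    using disj[of i j] that by blast
  have "(\<Prod>j\<in>u. - 1 + (\<Prod>i\<in>B j. 1 + c i)) = (\<Prod>j\<in>u. \<Sum>v\<in>Pow (B j) - {{}}. \<Prod>i\<in>v. c i)"
    using fB by (simp add: sum_prod_nonempty_subsets)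
  also have "\<dots> = (\<Sum>g\<in>(\<Pi>\<^sub>E j\<in>u. Pow (B j) - {{}}). \<Prod>j\<in>u. \<Prod>i\<in>g j. c i)"
    using fu fB by (intro prod_sum_PiE) auto
  also have "\<dots> = (\<Sum>w | w \<subseteq> (\<Union>j\<in>S. B j) \<and> {j \<in> S. w \<inter> B j \<noteq> {}} = u. \<Prod>i\<in>w. c i)"
  proof (rule sum.reindex_bij_witness[of _ "\<lambda>w. \<lambda>j\<in>u. w \<inter> B j" "\<lambda>g. \<Union>j\<in>u. g j"])
    fix g assume g: "g \<in> (\<Pi>\<^sub>E j\<in>u. Pow (B j) - {{}})"
    have sub: "g j \<subseteq> B j" "g j \<noteq> {}" if "j \<in> u" for j using g that by (auto simp: PiE_iff)
    have trace: "(\<Union>j\<in>u. g j) \<inter> B k = g k" if "k \<in> u" for k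
      using sub disj' u that by blast
    show "(\<lambda>j\<in>u. (\<Union>j\<in>u. g j) \<inter> B j) = g"
      using g trace by (intro ext) (auto simp: PiE_iff restrict_def extensional_def)
    have "{k \<in> S. (\<Union>j\<in>u. g j) \<inter> B k \<noteq> {}} = u"
    proof (intro equalityI subsetI)
      fix k assume "k \<in> {k \<in> S. (\<Union>j\<in>u. g j) \<inter> B k \<noteq> {}}"
      then obtain j x where "k \<in> S" "j \<in> u" "x \<in> g j" "x \<in> B k" by blast
      thus "k \<in> u" using sub(1)[of j] disj'[of x j k] u by blast
    next
      fix k assume "k \<in> u"
      thus "k \<in> {k \<in> S. (\<Union>j\<in>u. g j) \<inter> B k \<noteq> {}}" using trace[of k] sub(2)[of k] u by auto
    qed
    moreover have "(\<Union>j\<in>u. g j) \<subseteq> (\<Union>j\<in>S. B j)" using sub(1) u by blast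
    ultimately show "(\<Union>j\<in>u. g j) \<in> {w. w \<subseteq> (\<Union>j\<in>S. B j) \<and> {j \<in> S. w \<inter> B j \<noteq> {}} = u}"
      by simp
    show "(\<Prod>i\<in>(\<Union>j\<in>u. g j). c i) = (\<Prod>j\<in>u. \<Prod>i\<in>g j. c i)"
    proof (rule prod.UNION_disjoint)
      show "\<forall>i\<in>u. finite (g i)" using sub(1) fB finite_subset by blast
      show "\<forall>i\<in>u. \<forall>j\<in>u. i \<noteq> j \<longrightarrow> g i \<inter> g j = {}" using sub(1) disj u by blast
    qed (rule fu)
  next
    fix w assume "w \<in> {w. w \<subseteq> (\<Union>j\<in>S. B j) \<and> {j \<in> S. w \<inter> B j \<noteq> {}} = u}"
    hence w: "w \<subseteq> (\<Union>j\<in>S. B j)" "{j \<in> S. w \<inter> B j \<noteq> {}} = u" by auto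
    show "(\<lambda>j\<in>u. w \<inter> B j) \<in> (\<Pi>\<^sub>E j\<in>u. Pow (B j) - {{}})" using w(2) by auto
    have "(\<Union>j\<in>u. (\<lambda>j\<in>u. w \<inter> B j) j) = (\<Union>j\<in>u. w \<inter> B j)" by simp
    also have "\<dots> = w" using w by blast
    finally show "(\<Union>j\<in>u. (\<lambda>j\<in>u. w \<inter> B j) j) = w" .
  qed
  finally show ?thesis by simp
qed

text \<open>Division by \<open>d\<close> finds the block of a coordinate, so distinct blocks are
  disjoint and together they cover all coordinates.\<close>

lemma mem_block_iff:
  fixes d i j :: nat
  assumes "1 \<le> d" "1 \<le> j"
  shows "i \<in> {d * (j - 1) + 1..d * j} \<longleftrightarrow> 1 \<le> i \<and> j = (i - 1) div d + 1"
proof -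
  obtain k where j: "j = Suc k" using assms by (cases j) auto
  show ?thesis
  proof (cases i)
    case (Suc h)
    have "h div d = k \<longleftrightarrow> d * k \<le> h \<and> h < d * Suc k"
      using assms(1) less_eq_div_iff_mult_less_eq[of d k h] div_less_iff_less_mult[of d h "Suc k"]
      by (auto simp: mult.commute)
    thus ?thesis using j Suc by auto
  qed auto
qed

lemma UN_blocks:
  fixes d s :: nat
  assumes "1 \<le> d"
  shows "(\<Union>j\<in>{1..s}. {d * (j - 1) + 1..d * j}) = {1..d * s}"
proof (intro equalityI subsetI)
  fix i assume "i \<in> (\<Union>j\<in>{1..s}. {d * (j - 1) + 1..d * j})"
  then obtain j where "1 \<le> j" "j \<le> s" "i \<in> {d * (j - 1) + 1..d * j}" by auto
  moreover have "d * j \<le> d * s" using \<open>j \<le> s\<close> by (rule mult_le_mono2)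
  ultimately show "i \<in> {1..d * s}" by (auto intro: order_trans)
next
  fix i assume i: "i \<in> {1..d * s}"
  hence "i - 1 < s * d" unfolding mult.commute[of s d] atLeastAtMost_iff by linarith
  hence "(i - 1) div d < s" using assms by (simp add: div_less_iff_less_mult)
  moreover have "i \<in> {d * ((i - 1) div d + 1 - 1) + 1..d * ((i - 1) div d + 1)}"
    using mem_block_iff[OF assms, of "(i - 1) div d + 1" i] i by simp
  ultimately show "i \<in> (\<Union>j\<in>{1..s}. {d * (j - 1) + 1..d * j})"
    by (intro UN_I[of "(i - 1) div d + 1"]) auto
qed

lemma sum_prod_blocks:
  fixes c :: "nat \<Rightarrow> real"
  assumes "1 \<le> d" "u \<subseteq> {1..s}"
  shows "(\<Sum>w | w \<subseteq> {1..d * s} \<and> blocks d s w = u. \<Prod>i\<in>w. c i)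
           = (\<Prod>j\<in>u. - 1 + (\<Prod>l=1..d. 1 + c (d * (j - 1) + l)))"
proof -
  have "(\<Sum>w | w \<subseteq> {1..d * s} \<and> blocks d s w = u. \<Prod>i\<in>w. c i)
          = (\<Prod>j\<in>u. - 1 + (\<Prod>i\<in>{d * (j - 1) + 1..d * j}. 1 + c i))"
    unfolding blocks_def UN_blocks[OF assms(1), symmetric]
  proof (rule sum_prod_subsets_meeting)
    fix i j assume "i \<in> {1..s}" "j \<in> {1..s}" "i \<noteq> j"
    thus "{d * (i - 1) + 1..d * i} \<inter> {d * (j - 1) + 1..d * j} = {}"
      using mem_block_iff[OF assms(1)] by (metis atLeastAtMost_iff disjoint_iff)
  qed (use assms in auto)
  also have "\<dots> = (\<Prod>j\<in>u. - 1 + (\<Prod>l=1..d. 1 + c (d * (j - 1) + l)))"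
  proof (rule prod.cong[OF refl])
    fix j assume "j \<in> u"
    hence "d * j = d * (j - 1) + d" using assms(2) by (cases j) auto
    thus "- 1 + (\<Prod>i\<in>{d * (j - 1) + 1..d * j}. 1 + c i)
            = - 1 + (\<Prod>l=1..d. 1 + c (d * (j - 1) + l))"
      using prod.shift_bounds_cl_nat_ivl[of "\<lambda>i. 1 + c i" 1 "d * (j - 1)" d]
      by (simp add: add.commute)
  qed
  finally show ?thesis .
qed

text \<open>The blocks cover all coordinates, so a nonempty \<open>w\<close> meets one of them; this
  matches the two nonemptiness conditions in the regrouping.\<close>

lemma blocks_eq_empty_iff:
  assumes "1 \<le> d" "w \<subseteq> {1..d * s}"
  shows "blocks d s w = {} \<longleftrightarrow> w = {}"
  using assms(2) unfolding blocks_def UN_blocks[OF assms(1), symmetric] by blast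

text \<open>Grouping the \<open>w\<close> by the set \<open>u\<close> of blocks they meet makes the
  factor \<open>h\<close> constant in each group.\<close>

lemma sum_over_blocks:
  fixes c :: "nat \<Rightarrow> real"
  assumes "1 \<le> d"
  shows "(\<Sum>w | w \<noteq> {} \<and> w \<subseteq> {1..d * s}. h (blocks d s w) * (\<Prod>i\<in>w. c i))
           = (\<Sum>u | u \<noteq> {} \<and> u \<subseteq> {1..s}.
                h u * (\<Prod>j\<in>u. - 1 + (\<Prod>l=1..d. 1 + c (d * (j - 1) + l))))"
proof -
  let ?W = "{w. w \<noteq> {} \<and> w \<subseteq> {1..d * s}}" and ?U = "{u. u \<noteq> {} \<and> u \<subseteq> {1..s}}"
  have "(\<Sum>w\<in>?W. h (blocks d s w) * (\<Prod>i\<in>w. c i))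
          = (\<Sum>u\<in>?U. \<Sum>w | w \<in> ?W \<and> blocks d s w = u. h (blocks d s w) * (\<Prod>i\<in>w. c i))"
    using blocks_eq_empty_iff[OF assms]
    by (intro sum.group[symmetric]) (auto simp: blocks_def)
  also have "\<dots> = (\<Sum>u\<in>?U. h u * (\<Sum>w | w \<subseteq> {1..d * s} \<and> blocks d s w = u. \<Prod>i\<in>w. c i))"
  proof (intro sum.cong refl)
    fix u assume "u \<in> ?U"
    hence "{w. w \<in> ?W \<and> blocks d s w = u} = {w. w \<subseteq> {1..d * s} \<and> blocks d s w = u}"
      using blocks_eq_empty_iff[OF assms] by auto
    thus "(\<Sum>w | w \<in> ?W \<and> blocks d s w = u. h (blocks d s w) * (\<Prod>i\<in>w. c i))
            = h u * (\<Sum>w | w \<subseteq> {1..d * s} \<and> blocks d s w = u. \<Prod>i\<in>w. c i)"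
      by (simp add: sum_distrib_left)
  qed
  also have "\<dots> = (\<Sum>u\<in>?U. h u * (\<Prod>j\<in>u. - 1 + (\<Prod>l=1..d. 1 + c (d * (j - 1) + l))))"
    using sum_prod_blocks[OF assms] by (intro sum.cong) auto
  finally show ?thesis .
qed

section \<open>The criterion as an average over the point set\<close>

lemma v_map_eq_digit_val:
  "v_map m f = digit_val m (\<lambda>i. fls_nth f (int i + 1))" for f :: "'p::prime_card mod_ring fls"
proof -
  let ?g = "\<lambda>l. real_of_int (to_int_mod_ring (fls_nth f l)) * real CARD('p) powi (- l)"
  \<comment> \<open>Coefficients below the subdegree vanish, so the sum may start at 1 whatever the
    subdegree is.\<close>
  have "v_map m f = (\<Sum>l=1..int m. ?g l)"
    unfolding v_map_def by (rule sum.mono_neutral_left) auto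
  also have "\<dots> = (\<Sum>i<m. ?g (int i + 1))"
    by (rule sum.reindex_bij_witness[of _ "\<lambda>i. int i + 1" "\<lambda>l. nat (l - 1)"]) auto
  also have "\<dots> = digit_val m (\<lambda>i. fls_nth f (int i + 1))"
  proof -
    have "real CARD('p) powi (- (int i + 1)) = inverse (real CARD('p) ^ Suc i)" for i
      using power_int_minus[of "real CARD('p)" "int (Suc i)"] by (simp only: power_int_of_nat) (simp add: add.commute)
    thus ?thesis by (simp add: digit_val_def divide_inverse)
  qed
  finally show ?thesis .
qed

definition lattice_digits ::
  "(nat \<Rightarrow> 'p::prime_card mod_ring poly) \<Rightarrow> 'p mod_ring poly \<Rightarrow> nat \<Rightarrow> nat \<Rightarrow> nat \<Rightarrow> 'p mod_ring" where
  "lattice_digits q p n j i = fls_nth (poly_to_fls (nat_poly n * q j) / poly_to_fls p) (int i + 1)"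

lemma lattice_point_eq_digit_val: "lattice_point m q p n j = digit_val m (lattice_digits q p n j)"
  unfolding lattice_point_def v_map_eq_digit_val lattice_digits_def ..

lemma walsh_lattice_digits:
  "walsh m (lattice_digits q p n j) k = add_char (res_quot p (nat_poly n * (trunc_poly m k * q j)))"
  for p :: "'p::prime_card mod_ring poly"
proof -
  \<comment> \<open>The Walsh function pairs the digits of \<open>k\<close> with the digits of n q_j
    / p, so the product is reordered to make \<open>trunc_poly m k\<close> the expanded
    factor.\<close>
  have "nat_poly n * (trunc_poly m k * q j) = trunc_poly m k * (nat_poly n * q j)"
    by (simp only: mult_ac)
  thus ?thesis
    by (simp only: walsh_def res_quot_trunc_poly_mult add_char_sum lattice_digits_def)
qed

text \<open>Here the digits of \<open>n\<close> are expanded instead: the character value is a Walsh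
  function of index \<open>n\<close> on the residues of x^i h / p. Summing over \<open>n\<close>
  tests whether these all vanish, that is, whether \<open>p\<close> divides
  \<open>h\<close>.\<close>

lemma sum_add_char_res_quot:
  fixes p h :: "'p::prime_card mod_ring poly"
  assumes "degree p = m" "1 \<le> m"
  shows "(\<Sum>n<CARD('p) ^ m. add_char (res_quot p (nat_poly n * h)))
           = (if p dvd h then of_nat CARD('p) ^ m else 0)"
proof -
  let ?t = "\<lambda>i. res_quot p (Polynomial.monom 1 i * h)"
  have "add_char (res_quot p (nat_poly n * h)) = walsh m ?t n" if "n < CARD('p) ^ m" for n
    using that
    by (simp add: nat_poly_eq_trunc_poly res_quot_trunc_poly_mult walsh_def add_char_sum res_quot_monom_mult)
  hence "(\<Sum>n<CARD('p) ^ m. add_char (res_quot p (nat_poly n * h))) = (\<Sum>n<CARD('p) ^ m. walsh m ?t n)"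
    by (intro sum.cong) auto
  also have "\<dots> = (if p dvd h then of_nat CARD('p) ^ m else 0)"
    using assms by (simp add: sum_walsh dvd_iff_res_quot)
  finally show ?thesis .
qed

lemma zero_extend_mem_dual_net_iff:
  fixes p :: "'p::prime_card mod_ring poly"
  assumes "w \<subseteq> {1..t}"
  shows "zero_extend t w l \<in> dual_net m t q p \<longleftrightarrow> p dvd (\<Sum>j\<in>w. trunc_poly m (l j) * q j)"
proof -
  have "(\<Sum>j=1..t. trunc_poly m (zero_extend t w l j) * q j) = (\<Sum>j\<in>w. trunc_poly m (l j) * q j)"
    using assms by (intro sum.mono_neutral_cong_right) (auto simp: zero_extend_def)
  thus ?thesis by (simp add: dual_net_def cong_0_iff) (simp add: zero_extend_def)
qed

text \<open>The character merges the product over \<open>w\<close> into one residue of n h / p, with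
  h the sum of \<open>trunc_poly m (l j) * q j\<close>.\<close>

lemma dual_net_indicator:
  fixes p :: "'p::prime_card mod_ring poly"
  assumes "degree p = m" "1 \<le> m" "w \<subseteq> {1..t}"
  shows "(\<Sum>n<CARD('p) ^ m. \<Prod>j\<in>w. walsh m (lattice_digits q p n j) (l j))
           = (if zero_extend t w l \<in> dual_net m t q p then of_nat CARD('p) ^ m else 0)"
  unfolding walsh_lattice_digits add_char_sum[symmetric] res_quot_sum[symmetric]
    sum_distrib_left[symmetric] sum_add_char_res_quot[OF assms(1,2)]
    zero_extend_mem_dual_net_iff[OF assms(3)] ..

lemma has_sum_sum:
  fixes f :: "'i \<Rightarrow> 'a \<Rightarrow> 'b::topological_comm_monoid_add"
  assumes "\<And>i. i \<in> I \<Longrightarrow> (f i has_sum S i) A"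
  shows "((\<lambda>x. \<Sum>i\<in>I. f i x) has_sum (\<Sum>i\<in>I. S i)) A"
  using assms by (induction I rule: infinite_finite_induct) (auto intro!: has_sum_add)

text \<open>The dual net condition becomes an average over \<open>n\<close> of Walsh products, after
  which the finite sum over \<open>n\<close> is exchanged with the convergent series.\<close>

lemma infsum_dual_net:
  fixes p :: "'p::prime_card mod_ring poly"
  assumes "degree p = m" "1 \<le> m" "1 \<le> \<alpha>" "1 \<le> d" and w: "w \<subseteq> {1..t}"
  shows "(\<Sum>\<^sub>\<infinity>l | l \<in> w \<rightarrow>\<^sub>E {1..} \<and> zero_extend t w l \<in> dual_net m t q p.
            \<Prod>j\<in>w. r_weight CARD('p) \<alpha> d (l j))
         = 1 / real CARD('p) ^ m *
             (\<Sum>n<CARD('p) ^ m. \<Prod>j\<in>w. chi CARD('p) \<alpha> d (lattice_point m q p n j))"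
proof -
  let ?r = "\<lambda>l. \<Prod>j\<in>w. r_weight CARD('p) \<alpha> d (l j)"
  let ?D = "\<lambda>l. zero_extend t w l \<in> dual_net m t q p"
  let ?c = "1 / real CARD('p) ^ m"
  let ?v = "?c * (\<Sum>n<CARD('p) ^ m. \<Prod>j\<in>w. chi CARD('p) \<alpha> d (lattice_point m q p n j))"
  have fw: "finite w" using w finite_subset by blast
  have "((\<lambda>l. of_real ?c * (\<Sum>n<CARD('p) ^ m. \<Prod>j\<in>w. walsh_series m \<alpha> d (lattice_digits q p n j) (l j)))
           has_sum of_real ?v) (w \<rightarrow>\<^sub>E {1..})"
    unfolding of_real_mult[of ?c] of_real_sum lattice_point_eq_digit_val
    by (intro has_sum_cmult_right has_sum_sum has_sum_prod_walsh_series assms fw) 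
  moreover have "of_real ?c * (\<Sum>n<CARD('p) ^ m. \<Prod>j\<in>w. walsh_series m \<alpha> d (lattice_digits q p n j) (l j))
      = of_real (if ?D l then ?r l else 0)" for l
    unfolding walsh_series_def prod.distrib sum_distrib_left[symmetric]
      dual_net_indicator[OF assms(1,2) w]
    by (simp add: mult.commute)
  ultimately have "((\<lambda>l. of_real (if ?D l then ?r l else 0) :: complex) has_sum of_real ?v) (w \<rightarrow>\<^sub>E {1..})"
    by simp
  \<comment> \<open>Both the terms and the value are embedded reals, so the complex statement
    descends to the reals.\<close>
  hence "((\<lambda>l. if ?D l then ?r l else 0) has_sum ?v) (w \<rightarrow>\<^sub>E {1..})"
    by (simp only: has_sum_of_real_iff)
  hence "(?r has_sum ?v) {l. l \<in> w \<rightarrow>\<^sub>E {1..} \<and> ?D l}"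
    by (rule has_sum_cong_neutral[THEN iffD1, rotated -1]) auto
  thus ?thesis by (rule infsumI)
qed

text \<open>For each point separately the sum over \<open>w\<close> is grouped by blocks, with
  weight and constant together as the factor that depends only on the blocks met.\<close>

lemma B_crit_eq:
  fixes p :: "'p::prime_card mod_ring poly"
  assumes "degree p = m" "1 \<le> m" "1 \<le> \<alpha>" "1 \<le> d"
  shows "B_crit m s \<alpha> d \<gamma> q p =
       1 / real CARD('p) ^ m *
         (\<Sum>n<CARD('p) ^ m. \<Sum>u | u \<noteq> {} \<and> u \<subseteq> {1..s}.
            \<gamma> u * D_tilde CARD('p) \<alpha> d ^ card u *
              (\<Prod>j\<in>u. - 1 +
                 (\<Prod>l=1..d. 1 + chi CARD('p) \<alpha> d (lattice_point m q p n (d * (j - 1) + l)))))"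
proof -
  let ?h = "\<lambda>u. \<gamma> u * D_tilde CARD('p) \<alpha> d ^ card u"
  let ?chi = "\<lambda>n j. chi CARD('p) \<alpha> d (lattice_point m q p n j)"
  have "B_crit m s \<alpha> d \<gamma> q p = (\<Sum>w | w \<noteq> {} \<and> w \<subseteq> {1..d * s}. ?h (blocks d s w) *
          (1 / real CARD('p) ^ m * (\<Sum>n<CARD('p) ^ m. \<Prod>j\<in>w. ?chi n j)))"
    unfolding B_crit_def by (intro sum.cong refl, subst infsum_dual_net[OF assms]) auto
  also have "\<dots> = 1 / real CARD('p) ^ m * (\<Sum>n<CARD('p) ^ m.
                 \<Sum>w | w \<noteq> {} \<and> w \<subseteq> {1..d * s}. ?h (blocks d s w) * (\<Prod>j\<in>w. ?chi n j))"
    by (subst sum.swap) (simp add: sum_distrib_left mult_ac)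
  finally show ?thesis by (simp only: sum_over_blocks[OF assms(4), where h = ?h])
qed

theorem corollary1:
  fixes b m s \<alpha> d :: nat
    and \<gamma> :: "nat set \<Rightarrow> real"
    and p :: "'p::prime_card mod_ring poly"
    and q :: "nat \<Rightarrow> 'p mod_ring poly"
  assumes "b = CARD('p)"
    and "m \<ge> 1" and "s \<ge> 1" and "d \<ge> 1" and "\<alpha> \<ge> 2"
    and "\<forall>u\<subseteq>{1..s}. \<gamma> u \<ge> 0"
    and "degree p = m"
  shows
    "B_crit m s \<alpha> d \<gamma> q p =
       1 / real b ^ m *
         (\<Sum>n<b ^ m. \<Sum>u | u \<noteq> {} \<and> u \<subseteq> {1..s}.
            \<gamma> u * D_tilde b \<alpha> d ^ card u *
              (\<Prod>j\<in>u. - 1 + (\<Prod>l=1..d. 1 + chi b \<alpha> d (lattice_point m q p n (d * (j - 1) + l)))))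
     \<and>
     (\<forall>g :: nat \<Rightarrow> real. (\<forall>u\<subseteq>{1..s}. \<gamma> u = (\<Prod>j\<in>u. g j)) \<longrightarrow>
       B_crit m s \<alpha> d \<gamma> q p =
         - 1 + 1 / real b ^ m *
           (\<Sum>n<b ^ m. \<Prod>j=1..s.
              1 - g j * D_tilde b \<alpha> d + g j * D_tilde b \<alpha> d *
                (\<Prod>l=1..d. 1 + chi b \<alpha> d (lattice_point m q p n (d * (j - 1) + l)))))"
proof (intro conjI allI impI)
  let ?D = "D_tilde b \<alpha> d"
  let ?P = "\<lambda>n j. \<Prod>l=1..d. 1 + chi b \<alpha> d (lattice_point m q p n (d * (j - 1) + l))"
  show *: "B_crit m s \<alpha> d \<gamma> q p = 1 / real b ^ m *
         (\<Sum>n<b ^ m. \<Sum>u | u \<noteq> {} \<and> u \<subseteq> {1..s}. \<gamma> u * ?D ^ card u * (\<Prod>j\<in>u. - 1 + ?P n j))"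
    unfolding \<open>b = CARD('p)\<close> using assms by (intro B_crit_eq) auto
  fix g :: "nat \<Rightarrow> real"
  assume g: "\<forall>u\<subseteq>{1..s}. \<gamma> u = (\<Prod>j\<in>u. g j)"
  \<comment> \<open>Product weights distribute over \<open>u\<close>, so the sum over nonempty
    \<open>u\<close> is an expanded product without its empty term.\<close>
  have **: "(\<Sum>u | u \<noteq> {} \<and> u \<subseteq> {1..s}. \<gamma> u * ?D ^ card u * (\<Prod>j\<in>u. - 1 + ?P n j))
          = - 1 + (\<Prod>j=1..s. 1 - g j * ?D + g j * ?D * ?P n j)" for n
  proof -
    have "(\<Sum>u | u \<noteq> {} \<and> u \<subseteq> {1..s}. \<gamma> u * ?D ^ card u * (\<Prod>j\<in>u. - 1 + ?P n j))
            = (\<Sum>u\<in>Pow {1..s} - {{}}. \<Prod>j\<in>u. g j * ?D * (- 1 + ?P n j))"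
      using g by (intro sum.cong) (auto simp: prod.distrib)
    also have "\<dots> = - 1 + (\<Prod>j=1..s. 1 + g j * ?D * (- 1 + ?P n j))"
      by (rule sum_prod_nonempty_subsets) simp
    finally show ?thesis by (simp add: algebra_simps)
  qed
  \<comment> \<open>Averaging the constant -1 over the b^m points returns -1.\<close>
  have "real b ^ m \<noteq> 0" using assms(1) by simp
  thus "B_crit m s \<alpha> d \<gamma> q p =
         - 1 + 1 / real b ^ m * (\<Sum>n<b ^ m. \<Prod>j=1..s. 1 - g j * ?D + g j * ?D * ?P n j)"
    unfolding * ** by (simp add: sum_subtractf diff_divide_distrib)
qed

end
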